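(* Let $\mathcal{X}\subseteq\mathbb{R}^d$, let $\nu$ be a probability measure with support $\mathcal{X}$, and let $r:\mathcal{X}\to\mathbb{R}_{\ge0}$ be a noise variance function. Assume: 1. The observation points $X=[x_1,\ldots,x_N]^\top$ are sampled (independently) from the known probability measure $\nu$. 2. The data set $\overline U=[\overline u(x_1),\ldots,\overline u(x_N)]^\top$ satisfies $p(\overline U\mid v_X,X)=\mathcal{N}\left(v_X,\tfrac1M r_{XX}\right)$, where $v_X=[v(0,x_1),\ldots,v(0,x_N)]^\top$, arising from observations $u_j(x_i)=v(0,x_i)+\xi_{i,j}$ ($1\le i\le N$, $1\le j\le M$) with $\xi_{i,j}\sim\mathcal{N}(0,r(x_i))$ independent. 3. $r$ attains a positive minimum value $r_{\min}=\min_{x\in\mathcal{X}}r(x)>0$. Let $\overline r(x_i)=\frac{1}{M-1}\sum_{j=1}^M(u_j(x_i)-\overline u(x_i))^2$, $i^*:=\operatorname{argmin}_{i\in\{1,\ldots,N\}}\overline r(x_i)$ and $\overline r_{\min}:=\overline r(x_{i^*})$. Then for any $N\ge1$, $M\ge2$, $\delta>0$ and $\epsilon>\delta$, $$\mathrm{Pr}\left(|\overline r_{\min}-r_{\min}|\ge\epsilon,\ \delta>|r(x_{i^*})-r_{\min}|\right)\le 1-\prod_{i=1}^N\max\left\{1-\frac{2r^2(x_i)}{(\epsilon-\delta)^2(M-1)},\,0\right\},$$ where the probability is over the noise $\{\xi_{i,j}\}$, given the observation points $x_1,\ldots,x_N$.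
   Context: $v:[0,T]\times\mathbb{R}^d\to\mathbb{R}$ is the (unique viscosity) solution of the Kolmogorov PDE $\partial_t v+\frac12\operatorname{tr}\{a a^\top\partial_{xx}v\}+b^\top\partial_x v+c\,v+h=0$ on $[0,T)\times\mathbb{R}^d$, $v(T,x)=g(x)$, where $T>0$, $b:[0,T]\times\mathbb{R}^d\to\mathbb{R}^d$, $a:[0,T]\times\mathbb{R}^d\to\mathbb{R}^{d\times m}$, $c,h:[0,T]\times\mathbb{R}^d\to\mathbb{R}$, $g:\mathbb{R}^d\to\mathbb{R}$. The functions $a,b,c,h$ are uniformly continuous, $c$ is bounded, and there is $L>0$ such that each $\varphi\in\{a,b,c,h\}$ satisfies $|\varphi(t,x)-\varphi(t,x')|\le L|x-x'|$ and $|\varphi(t,0)|\le L$ for all $t\in[0,T]$, $x,x'\in\mathbb{R}^d$. Only the deterministic values $v(0,x_i)$ enter the statement. $\overline u(x_i)=\frac1M\sum_{j=1}^M u_j(x_i)$ is the sample mean at $x_i$; $\overline r(x_i)$ is the unbiased sample variance of $\{u_j(x_i)\}_{j=1}^M$. The noise variance matrix $r_{XX}\in\mathbb{R}^{N\times N}$ is $[r_{XX}]_{ij}=\delta_{ij}r(x_i)$. The random variables $\xi_{i,j}$ are independent over all pairs $(i,j)$, and $i^*$ is a (random) index minimizing $\overline r(x_i)$. The notation $r^2(x_i)$ means $(r(x_i))^2$. *)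

theory Defs
  imports "HOL-Probability.Probability"
begin

section \<open>The Kolmogorov equation\<close>

text \<open>
  The space variable ranges over \<open>real ^ 'd\<close>, and \<open>a t x\<close> is a matrix with rows indexed by \<open>'d\<close>
  and columns indexed by \<open>'m\<close>. Its norm is the Frobenius norm. All functions of time are total
  on \<open>real\<close>; only their values for times in \<open>{0..T}\<close> matter.
\<close>

definition lipschitz_linear_growth ::
    "real \<Rightarrow> real \<Rightarrow> (real \<Rightarrow> real ^ 'd \<Rightarrow> 'b::real_normed_vector) \<Rightarrow> bool" where
  "lipschitz_linear_growth T L f \<longleftrightarrow>
     (\<forall>t\<in>{0..T}. \<forall>x x'. norm (f t x - f t x') \<le> L * norm (x - x')) \<and>
     (\<forall>t\<in>{0..T}. norm (f t 0) \<le> L)"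

definition kolmogorov_coefficients ::
    "real \<Rightarrow> real \<Rightarrow> (real \<Rightarrow> real ^ 'd \<Rightarrow> real ^ 'm ^ 'd) \<Rightarrow> (real \<Rightarrow> real ^ 'd \<Rightarrow> real ^ 'd) \<Rightarrow>
     (real \<Rightarrow> real ^ 'd \<Rightarrow> real) \<Rightarrow> (real \<Rightarrow> real ^ 'd \<Rightarrow> real) \<Rightarrow> bool" where
  "kolmogorov_coefficients T L a b c h \<longleftrightarrow>
     uniformly_continuous_on ({0..T} \<times> UNIV) (\<lambda>(t, x). a t x) \<and>
     uniformly_continuous_on ({0..T} \<times> UNIV) (\<lambda>(t, x). b t x) \<and>
     uniformly_continuous_on ({0..T} \<times> UNIV) (\<lambda>(t, x). c t x) \<and>
     uniformly_continuous_on ({0..T} \<times> UNIV) (\<lambda>(t, x). h t x) \<and>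
     bounded ((\<lambda>(t, x). c t x) ` ({0..T} \<times> UNIV)) \<and>
     lipschitz_linear_growth T L a \<and> lipschitz_linear_growth T L b \<and>
     lipschitz_linear_growth T L c \<and> lipschitz_linear_growth T L h"

text \<open>
  Test functions of class \<open>C\<^sup>1\<^sup>,\<^sup>2\<close> on \<open>{0..<T} \<times> UNIV\<close>, together with their time derivative (one-sided
  at time 0), spatial gradient and spatial Hessian.
\<close>

definition C12_test_function ::
    "real \<Rightarrow> (real \<Rightarrow> real ^ 'd \<Rightarrow> real) \<Rightarrow> (real \<Rightarrow> real ^ 'd \<Rightarrow> real) \<Rightarrow>
     (real \<Rightarrow> real ^ 'd \<Rightarrow> real ^ 'd) \<Rightarrow> (real \<Rightarrow> real ^ 'd \<Rightarrow> real ^ 'd ^ 'd) \<Rightarrow> bool" where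
  "C12_test_function T \<phi> \<phi>t \<phi>x \<phi>xx \<longleftrightarrow>
     (\<forall>t\<in>{0..<T}. \<forall>x.
        ((\<lambda>s. \<phi> s x) has_real_derivative \<phi>t t x) (at t within {0..<T}) \<and>
        ((\<lambda>y. \<phi> t y) has_derivative (\<lambda>z. \<phi>x t x \<bullet> z)) (at x) \<and>
        ((\<lambda>y. \<phi>x t y) has_derivative (\<lambda>z. \<phi>xx t x *v z)) (at x)) \<and>
     continuous_on ({0..<T} \<times> UNIV) (\<lambda>(t, x). \<phi> t x) \<and>
     continuous_on ({0..<T} \<times> UNIV) (\<lambda>(t, x). \<phi>t t x) \<and>
     continuous_on ({0..<T} \<times> UNIV) (\<lambda>(t, x). \<phi>x t x) \<and>
     continuous_on ({0..<T} \<times> UNIV) (\<lambda>(t, x). \<phi>xx t x)"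

text \<open>
  The left-hand side of the equation at \<open>(t, x)\<close>, where \<open>w\<close> is the value of the solution and
  \<open>q\<close>, \<open>p\<close>, \<open>H\<close> are its time derivative, gradient and Hessian.
\<close>

definition kolmogorov_operator ::
    "(real \<Rightarrow> real ^ 'd \<Rightarrow> real ^ 'm ^ 'd) \<Rightarrow> (real \<Rightarrow> real ^ 'd \<Rightarrow> real ^ 'd) \<Rightarrow>
     (real \<Rightarrow> real ^ 'd \<Rightarrow> real) \<Rightarrow> (real \<Rightarrow> real ^ 'd \<Rightarrow> real) \<Rightarrow>
     real \<Rightarrow> real ^ 'd \<Rightarrow> real \<Rightarrow> real \<Rightarrow> real ^ 'd \<Rightarrow> real ^ 'd ^ 'd \<Rightarrow> real" where
  "kolmogorov_operator a b c h t x w q p H =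
     q + trace (a t x ** transpose (a t x) ** H) / 2 + b t x \<bullet> p + c t x * w + h t x"

text \<open>
  For a terminal value problem, the subsolution inequality at a local maximum of \<open>v - \<phi>\<close> says that
  the operator is nonnegative, and the supersolution inequality at a local minimum says that it is
  nonpositive.
\<close>

definition viscosity_subsolution where
  "viscosity_subsolution T a b c h v \<longleftrightarrow>
     (\<forall>\<phi> \<phi>t \<phi>x \<phi>xx. C12_test_function T \<phi> \<phi>t \<phi>x \<phi>xx \<longrightarrow>
       (\<forall>t\<in>{0..<T}. \<forall>x.
         (\<forall>\<^sub>F (s, y) in at (t, x) within ({0..<T} \<times> UNIV). v s y - \<phi> s y \<le> v t x - \<phi> t x) \<longrightarrow>
         kolmogorov_operator a b c h t x (v t x) (\<phi>t t x) (\<phi>x t x) (\<phi>xx t x) \<ge> 0))"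

definition viscosity_supersolution where
  "viscosity_supersolution T a b c h v \<longleftrightarrow>
     (\<forall>\<phi> \<phi>t \<phi>x \<phi>xx. C12_test_function T \<phi> \<phi>t \<phi>x \<phi>xx \<longrightarrow>
       (\<forall>t\<in>{0..<T}. \<forall>x.
         (\<forall>\<^sub>F (s, y) in at (t, x) within ({0..<T} \<times> UNIV). v s y - \<phi> s y \<ge> v t x - \<phi> t x) \<longrightarrow>
         kolmogorov_operator a b c h t x (v t x) (\<phi>t t x) (\<phi>x t x) (\<phi>xx t x) \<le> 0))"

definition viscosity_solution ::
    "real \<Rightarrow> (real \<Rightarrow> real ^ 'd \<Rightarrow> real ^ 'm ^ 'd) \<Rightarrow> (real \<Rightarrow> real ^ 'd \<Rightarrow> real ^ 'd) \<Rightarrow>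
     (real \<Rightarrow> real ^ 'd \<Rightarrow> real) \<Rightarrow> (real \<Rightarrow> real ^ 'd \<Rightarrow> real) \<Rightarrow> (real ^ 'd \<Rightarrow> real) \<Rightarrow>
     (real \<Rightarrow> real ^ 'd \<Rightarrow> real) \<Rightarrow> bool" where
  "viscosity_solution T a b c h g v \<longleftrightarrow>
     continuous_on ({0..T} \<times> UNIV) (\<lambda>(t, x). v t x) \<and>
     viscosity_subsolution T a b c h v \<and> viscosity_supersolution T a b c h v \<and>
     (\<forall>x. v T x = g x)"

section \<open>Probabilistic notions\<close>

definition measure_support :: "'a::topological_space measure \<Rightarrow> 'a set" where
  "measure_support \<nu> = {x. \<forall>U. open U \<longrightarrow> x \<in> U \<longrightarrow> emeasure \<nu> U > 0}"

text \<open>\<open>P x\<close> is the conditional probability on \<open>\<Omega>\<close> given that the random element \<open>X\<close> equals \<open>x\<close>.\<close>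

definition regular_conditional_probability ::
    "'w measure \<Rightarrow> 's measure \<Rightarrow> ('w \<Rightarrow> 's) \<Rightarrow> ('s \<Rightarrow> 'w measure) \<Rightarrow> bool" where
  "regular_conditional_probability \<Omega> S X P \<longleftrightarrow>
     X \<in> measurable \<Omega> S \<and> P \<in> measurable S (prob_algebra \<Omega>) \<and>
     (\<forall>A\<in>sets \<Omega>. \<forall>B\<in>sets S.
        emeasure \<Omega> (A \<inter> (X -` B \<inter> space \<Omega>)) = (\<integral>\<^sup>+x\<in>B. emeasure (P x) A \<partial>distr \<Omega> S X))"

text \<open>The parameter \<open>s\<close> is the variance; the law with variance 0 is the point mass at the mean.\<close>

definition gaussian :: "real \<Rightarrow> real \<Rightarrow> real measure" where
  "gaussian \<mu> s = (if s = 0 then return borel \<mu> else density lborel (normal_density \<mu> (sqrt s)))"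

text \<open>
  The random vector \<open>(Y i)\<close>, \<open>i \<in> I\<close>, has the multivariate normal law with mean vector \<open>\<mu>\<close> and
  covariance matrix \<open>\<Sigma>\<close>, in the sense that each of its linear combinations has the corresponding
  normal law on the real line.
\<close>

definition multivariate_gaussian ::
    "'w measure \<Rightarrow> 'i set \<Rightarrow> ('i \<Rightarrow> 'w \<Rightarrow> real) \<Rightarrow> ('i \<Rightarrow> real) \<Rightarrow> ('i \<Rightarrow> 'i \<Rightarrow> real) \<Rightarrow> bool" where
  "multivariate_gaussian P I Y \<mu> \<Sigma> \<longleftrightarrow>
     (\<forall>i\<in>I. Y i \<in> borel_measurable P) \<and>
     (\<forall>w. distr P borel (\<lambda>\<omega>. \<Sum>i\<in>I. w i * Y i \<omega>) =
        gaussian (\<Sum>i\<in>I. w i * \<mu> i) (\<Sum>i\<in>I. \<Sum>j\<in>I. w i * w j * \<Sigma> i j))"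

definition noise_matrix :: "('a \<Rightarrow> real) \<Rightarrow> (nat \<Rightarrow> 'a) \<Rightarrow> nat \<Rightarrow> nat \<Rightarrow> real" where
  "noise_matrix r x i j = (if i = j then r (x i) else 0)"

definition sample_mean :: "nat \<Rightarrow> (nat \<Rightarrow> real) \<Rightarrow> real" where
  "sample_mean M y = (\<Sum>j=1..M. y j) / real M"

definition sample_variance :: "nat \<Rightarrow> (nat \<Rightarrow> real) \<Rightarrow> real" where
  "sample_variance M y = (\<Sum>j=1..M. (y j - sample_mean M y)\<^sup>2) / (real M - 1)"

end

theory Submission
  imports Defs
begin

text \<open>
  If \<open>r_bar_min\<close> is at least \<open>\<epsilon>\<close> away from \<open>r_min\<close> although the true variance at the selected point
  is within \<open>\<delta>\<close> of \<open>r_min\<close>, then by the triangle inequality the sample variance at the selected point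
  misses the true variance there by more than \<open>\<epsilon> - \<delta>\<close>. The selected index depends on the noise in a
  complicated way, so this is enlarged to the event that the sample variance at \<^emph>\<open>some\<close> observation
  point misses the true variance by at least \<open>\<epsilon> - \<delta>\<close>. The complement of the larger event is an
  intersection of independent events, one per observation point, and Chebyshev's inequality bounds
  the probability of each from below; multiplying gives the product in the claim
  (\<open>indep_vars_Chebyshev_simultaneous\<close>).

  Chebyshev's inequality needs the mean and the variance of the sample variance of \<open>M\<close> observations.
  The shift \<open>v 0 (X i \<omega>)\<close> is common to all observations at a point and cancels in the sample
  variance, so only the centred noise enters.
  The classical formula, for noise with second moment \<open>s\<close> and fourth moment \<open>m4\<close>, is
  \<open>m4 / M - s\<^sup>2 (M - 3) / (M (M - 1))\<close>, which is \<open>2 s\<^sup>2 / (M - 1)\<close> in the Gaussian case \<open>m4 = 3 s\<^sup>2\<close>.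
  It is read off from the joint moments of the sum and the sum of squares of the noise
  (\<open>power_sum_moments\<close>).

  Everything happens under the conditional law \<open>P x\<close> for fixed \<open>x\<close>. Almost every design \<open>x\<close> lies in
  the support of \<open>\<nu>\<close> (\<open>AE_in_measure_support\<close>), where \<open>r\<close> is bounded below by \<open>r_min > 0\<close>; thus the
  noise is nondegenerate and its laws have normal densities.
\<close>

section \<open>Full measure of the support\<close>

text \<open>
  The complement of the support is the union of all open null sets. By second countability it is
  already the union of the null sets in a countable basis, hence null.
\<close>

lemma AE_in_measure_support:
  fixes \<nu> :: "'a::second_countable_topology measure"
  assumes "sets \<nu> = sets borel"
  shows "AE x in \<nu>. x \<in> measure_support \<nu>"
proof -
  obtain B :: "'a set set" where B: "countable B" "topological_basis B"
    using ex_countable_basis by blast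
  let ?B0 = "{U \<in> B. emeasure \<nu> U = 0}"
  have open_B: "open U" if "U \<in> B" for U
    using B(2) that by (rule topological_basis_open)
  have "(\<Union>U\<in>?B0. U) \<in> null_sets \<nu>"
    using B(1) open_B assms by (intro null_sets_UN') (auto simp: null_sets_def)
  moreover have "{x \<in> space \<nu>. x \<notin> measure_support \<nu>} \<subseteq> (\<Union>U\<in>?B0. U)"
  proof safe
    fix x assume "x \<notin> measure_support \<nu>"
    then obtain V where V: "open V" "x \<in> V" "emeasure \<nu> V = 0"
      unfolding measure_support_def by (auto simp: zero_less_iff_neq_zero)
    obtain U where U: "U \<in> B" "x \<in> U" "U \<subseteq> V"
      using topological_basisE[OF B(2) V(1,2)] by blast
    have "emeasure \<nu> U \<le> emeasure \<nu> V"
      using U V assms by (intro emeasure_mono) auto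
    with U V show "x \<in> (\<Union>U\<in>?B0. U)" by auto
  qed
  ultimately show ?thesis
    by (rule AE_I')
qed

section \<open>Algebra of the sample variance\<close>

lemma sample_variance_shift:
  assumes "M > 0"
  shows "sample_variance M (\<lambda>j. m + y j) = sample_variance M y"
proof -
  have "sample_mean M (\<lambda>j. m + y j) = m + sample_mean M y"
    using assms by (simp add: sample_mean_def sum.distrib field_simps)
  then show ?thesis
    by (simp add: sample_variance_def)
qed

lemma sample_variance_cong:
  assumes "\<And>j. j \<in> {1..M} \<Longrightarrow> y j = z j"
  shows "sample_variance M y = sample_variance M z"
  using assms by (simp add: sample_variance_def sample_mean_def)

text \<open>
  In this form the moments of the sample variance reduce to joint moments of two sums over the
  sample, which can be computed by adding one observation at a time.
\<close>

lemma sample_variance_power_sums: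
  assumes "M > 0"
  shows "sample_variance M y =
    ((\<Sum>j=1..M. (y j)\<^sup>2) - (\<Sum>j=1..M. y j)\<^sup>2 / real M) / (real M - 1)"
proof -
  let ?m = "sample_mean M y"
  have S: "(\<Sum>j=1..M. y j) = real M * ?m"
    using assms by (simp add: sample_mean_def)
  have "(\<Sum>j=1..M. (y j - ?m)\<^sup>2) = (\<Sum>j=1..M. (y j)\<^sup>2 - 2 * ?m * y j + ?m\<^sup>2)"
    by (intro sum.cong) (auto simp: power2_diff)
  also have "\<dots> = (\<Sum>j=1..M. (y j)\<^sup>2) - 2 * ?m * (\<Sum>j=1..M. y j) + real M * ?m\<^sup>2"
    by (simp add: sum.distrib sum_subtractf flip: sum_distrib_left)
  also have "\<dots> = (\<Sum>j=1..M. (y j)\<^sup>2) - (\<Sum>j=1..M. y j)\<^sup>2 / real M"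
    unfolding S using assms by (simp add: power2_eq_square field_simps)
  finally show ?thesis
    by (simp add: sample_variance_def)
qed

section \<open>Moments of the sample variance\<close>

lemma has_bochner_integral_eqI:
  assumes "has_bochner_integral M f x" "\<And>\<omega>. f \<omega> = g \<omega>" "x = y"
  shows "has_bochner_integral M g y"
proof -
  have "f = g" using assms(2) by (rule ext)
  then show ?thesis using assms by simp
qed

lemma has_bochner_integral_scale:
  fixes f :: "'a \<Rightarrow> real"
  assumes "has_bochner_integral M f x"
  shows "has_bochner_integral M (\<lambda>\<omega>. c * f \<omega>) (c * x)"
  using assms by (rule has_bochner_integral_mult_right)

context prob_space
begin

text \<open>
  Carrying integrability and value of an expectation in one statement lets moments be computed by
  resolution, without separate integrability proofs.
\<close>

lemma indep_var_has_bochner_integral_mult: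
  fixes X Y :: "'a \<Rightarrow> real"
  assumes "indep_var borel X borel Y"
    and "has_bochner_integral M X x" "has_bochner_integral M Y y"
  shows "has_bochner_integral M (\<lambda>\<omega>. X \<omega> * Y \<omega>) (x * y)"
  using assms indep_var_integrable[of X Y] indep_var_lebesgue_integral[of X Y]
  by (simp add: has_bochner_integral_iff)

text \<open>
  Adding an observation \<open>x\<close> replaces the sum \<open>S\<close> by \<open>S + x\<close> and the sum of squares \<open>A\<close> by \<open>A + x\<^sup>2\<close>.
  Since \<open>x\<close> is independent of \<open>(S, A)\<close>, expanding a monomial in the new sums expresses its mean by
  moments of \<open>x\<close> and of lower monomials in the old ones. The sample variance needs only \<open>A\<close>, \<open>S\<^sup>2\<close>, \<open>A\<^sup>2\<close>,
  \<open>A S\<^sup>2\<close> and \<open>S\<^sup>4\<close>; the other monomials close the list under this recursion, mainly to supply the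
  integrability of cross terms whose mean vanishes because \<open>x\<close> or \<open>S\<close> is centred.
\<close>

lemma power_sum_moments:
  fixes Y :: "'i \<Rightarrow> 'a \<Rightarrow> real" and s m3 m4 :: real
  assumes "finite I" "indep_vars (\<lambda>_. borel) Y I"
    and "\<And>i. i \<in> I \<Longrightarrow> has_bochner_integral M (Y i) 0"
    and "\<And>i. i \<in> I \<Longrightarrow> has_bochner_integral M (\<lambda>\<omega>. Y i \<omega> ^ 2) s"
    and "\<And>i. i \<in> I \<Longrightarrow> has_bochner_integral M (\<lambda>\<omega>. Y i \<omega> ^ 3) m3"
    and "\<And>i. i \<in> I \<Longrightarrow> has_bochner_integral M (\<lambda>\<omega>. Y i \<omega> ^ 4) m4"
  defines "S \<equiv> \<lambda>I \<omega>. \<Sum>i\<in>I. Y i \<omega>" and "A \<equiv> \<lambda>I \<omega>. \<Sum>i\<in>I. (Y i \<omega>)\<^sup>2"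
    and "n \<equiv> \<lambda>I. real (card I)"
  shows "has_bochner_integral M (S I) 0 \<and>
    has_bochner_integral M (A I) (n I * s) \<and>
    has_bochner_integral M (\<lambda>\<omega>. S I \<omega> ^ 2) (n I * s) \<and>
    has_bochner_integral M (\<lambda>\<omega>. A I \<omega> * S I \<omega>) (n I * m3) \<and>
    has_bochner_integral M (\<lambda>\<omega>. S I \<omega> ^ 3) (n I * m3) \<and>
    has_bochner_integral M (\<lambda>\<omega>. A I \<omega> ^ 2) (n I * m4 + n I * (n I - 1) * s\<^sup>2) \<and>
    has_bochner_integral M (\<lambda>\<omega>. A I \<omega> * S I \<omega> ^ 2) (n I * m4 + n I * (n I - 1) * s\<^sup>2) \<and>
    has_bochner_integral M (\<lambda>\<omega>. S I \<omega> ^ 4) (n I * m4 + 3 * n I * (n I - 1) * s\<^sup>2)"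
  using assms(1-6)
proof (induction I rule: finite_induct)
  case empty
  show ?case
    by (simp add: S_def A_def n_def has_bochner_integral_zero)
next
  case (insert i I)
  let ?x = "Y i"
  have "indep_vars (\<lambda>_. borel) Y I"
    using insert.prems(1) by (rule indep_vars_subset) auto
  then have IH: "has_bochner_integral M (S I) 0"
    "has_bochner_integral M (A I) (n I * s)"
    "has_bochner_integral M (\<lambda>\<omega>. S I \<omega> ^ 2) (n I * s)"
    "has_bochner_integral M (\<lambda>\<omega>. A I \<omega> * S I \<omega>) (n I * m3)"
    "has_bochner_integral M (\<lambda>\<omega>. S I \<omega> ^ 3) (n I * m3)"
    "has_bochner_integral M (\<lambda>\<omega>. A I \<omega> ^ 2) (n I * m4 + n I * (n I - 1) * s\<^sup>2)"
    "has_bochner_integral M (\<lambda>\<omega>. A I \<omega> * S I \<omega> ^ 2) (n I * m4 + n I * (n I - 1) * s\<^sup>2)"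
    "has_bochner_integral M (\<lambda>\<omega>. S I \<omega> ^ 4) (n I * m4 + 3 * n I * (n I - 1) * s\<^sup>2)"
    using insert.IH insert.prems by auto
  have x: "has_bochner_integral M ?x 0" "has_bochner_integral M (\<lambda>\<omega>. ?x \<omega> ^ 2) s"
    "has_bochner_integral M (\<lambda>\<omega>. ?x \<omega> ^ 3) m3" "has_bochner_integral M (\<lambda>\<omega>. ?x \<omega> ^ 4) m4"
    using insert.prems by auto
  \<comment> \<open>The variable \<open>Z\<close> stands for a function \<open>g\<close> of the pair of old sums; the new observation is
    independent of the block of old ones.\<close>
  have mult: "has_bochner_integral M (\<lambda>\<omega>. f (?x \<omega>) * Z \<omega>) (p * q)"
    if "has_bochner_integral M (\<lambda>\<omega>. f (?x \<omega>)) p"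
      and "has_bochner_integral M Z q"
      and Z: "\<And>\<omega>. Z \<omega> = g (A I \<omega>, S I \<omega>)"
      and "f \<in> borel_measurable borel"
      and "g \<in> borel_measurable (borel \<Otimes>\<^sub>M borel)"
    for f :: "real \<Rightarrow> real" and g :: "real \<times> real \<Rightarrow> real" and Z p q
  proof (rule indep_var_has_bochner_integral_mult)
    have coord: "(\<lambda>y. y j) \<in> borel_measurable (PiM J (\<lambda>_. borel :: real measure))"
      if "j \<in> J" for j :: 'i and J
      using that by (rule measurable_component_singleton)
    have f: "(\<lambda>y. f (y i)) \<in> borel_measurable (PiM {i} (\<lambda>_. borel))"
      by (rule measurable_compose[OF coord that(4)]) simp
    have "(\<lambda>y. (\<Sum>j\<in>I. (y j)\<^sup>2, \<Sum>j\<in>I. y j)) \<in>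
        PiM I (\<lambda>_. borel) \<rightarrow>\<^sub>M borel \<Otimes>\<^sub>M (borel :: real measure)"
      by (intro measurable_Pair borel_measurable_sum borel_measurable_power coord)
    then have g: "(\<lambda>y. g (\<Sum>j\<in>I. (y j)\<^sup>2, \<Sum>j\<in>I. y j)) \<in> borel_measurable (PiM I (\<lambda>_. borel))"
      using that(5) by (rule measurable_compose)
    have blocks: "indep_var
      (PiM {i} (\<lambda>_. borel)) (\<lambda>\<omega>. restrict (\<lambda>i. Y i \<omega>) {i})
      (PiM I (\<lambda>_. borel)) (\<lambda>\<omega>. restrict (\<lambda>i. Y i \<omega>) I)"
      using insert.hyps by (intro indep_var_restrict[OF insert.prems(1)]) auto
    have "indep_var
      borel ((\<lambda>y. f (y i)) \<circ> (\<lambda>\<omega>. restrict (\<lambda>i. Y i \<omega>) {i}))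
      borel ((\<lambda>y. g (\<Sum>j\<in>I. (y j)\<^sup>2, \<Sum>j\<in>I. y j)) \<circ> (\<lambda>\<omega>. restrict (\<lambda>i. Y i \<omega>) I))"
      by (rule indep_var_compose[OF blocks f g])
    then show "indep_var borel (\<lambda>\<omega>. f (?x \<omega>)) borel Z"
      by (simp add: comp_def Z[abs_def] A_def S_def)
  qed fact+
  note add = has_bochner_integral_add
  note scale = has_bochner_integral_scale
  note expand = power2_eq_square power3_eq_cube power4_eq_xxxx algebra_simps
  have xS: "has_bochner_integral M (\<lambda>\<omega>. ?x \<omega> * S I \<omega>) 0"
    using mult[of "\<lambda>x. x" _ _ _ snd, OF x(1) IH(1)] by simp
  have xA: "has_bochner_integral M (\<lambda>\<omega>. ?x \<omega> * A I \<omega>) 0"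
    using mult[of "\<lambda>x. x" _ _ _ fst, OF x(1) IH(2)] by simp
  have xS2: "has_bochner_integral M (\<lambda>\<omega>. ?x \<omega> * S I \<omega> ^ 2) 0"
    using mult[of "\<lambda>x. x" _ _ _ "\<lambda>y. snd y ^ 2", OF x(1) IH(3)] by simp
  have xAS: "has_bochner_integral M (\<lambda>\<omega>. ?x \<omega> * (A I \<omega> * S I \<omega>)) 0"
    using mult[of "\<lambda>x. x" _ _ _ "\<lambda>y. fst y * snd y", OF x(1) IH(4)] by simp
  have xS3: "has_bochner_integral M (\<lambda>\<omega>. ?x \<omega> * S I \<omega> ^ 3) 0"
    using mult[of "\<lambda>x. x" _ _ _ "\<lambda>y. snd y ^ 3", OF x(1) IH(5)] by simp
  have x2S: "has_bochner_integral M (\<lambda>\<omega>. ?x \<omega> ^ 2 * S I \<omega>) 0"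
    using mult[of "\<lambda>x. x ^ 2" _ _ _ snd, OF x(2) IH(1)] by simp
  have x2A: "has_bochner_integral M (\<lambda>\<omega>. ?x \<omega> ^ 2 * A I \<omega>) (s * (n I * s))"
    using mult[of "\<lambda>x. x ^ 2" _ _ _ fst, OF x(2) IH(2)] by simp
  have x2S2: "has_bochner_integral M (\<lambda>\<omega>. ?x \<omega> ^ 2 * S I \<omega> ^ 2) (s * (n I * s))"
    using mult[of "\<lambda>x. x ^ 2" _ _ _ "\<lambda>y. snd y ^ 2", OF x(2) IH(3)] by simp
  have x3S: "has_bochner_integral M (\<lambda>\<omega>. ?x \<omega> ^ 3 * S I \<omega>) 0"
    using mult[of "\<lambda>x. x ^ 3" _ _ _ snd, OF x(3) IH(1)] by simp
  have S': "S (insert i I) \<omega> = ?x \<omega> + S I \<omega>" and A': "A (insert i I) \<omega> = ?x \<omega> ^ 2 + A I \<omega>" for \<omega>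
    using insert.hyps by (simp_all add: S_def A_def)
  have n': "n (insert i I) = n I + 1"
    using insert.hyps by (simp add: n_def)
  show ?case
  proof (intro conjI)
    show "has_bochner_integral M (S (insert i I)) 0"
      by (rule has_bochner_integral_eqI[OF add[OF x(1) IH(1)]]) (simp_all add: S')
    show "has_bochner_integral M (A (insert i I)) (n (insert i I) * s)"
      by (rule has_bochner_integral_eqI[OF add[OF x(2) IH(2)]])
        (simp_all add: A' n' algebra_simps)
    show "has_bochner_integral M (\<lambda>\<omega>. S (insert i I) \<omega> ^ 2) (n (insert i I) * s)"
      by (rule has_bochner_integral_eqI[OF add[OF add[OF x(2) scale[where c = 2, OF xS]] IH(3)]])
        (simp_all add: S' n' expand)
    show "has_bochner_integral M (\<lambda>\<omega>. A (insert i I) \<omega> * S (insert i I) \<omega>) (n (insert i I) * m3)"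
      by (rule has_bochner_integral_eqI[OF add[OF add[OF add[OF x(3) x2S] xA] IH(4)]])
        (simp_all add: S' A' n' expand)
    show "has_bochner_integral M (\<lambda>\<omega>. S (insert i I) \<omega> ^ 3) (n (insert i I) * m3)"
      by (rule has_bochner_integral_eqI[OF add[OF add[OF add[OF x(3)
              scale[where c = 3, OF x2S]] scale[where c = 3, OF xS2]] IH(5)]])
        (simp_all add: S' n' expand)
    show "has_bochner_integral M (\<lambda>\<omega>. A (insert i I) \<omega> ^ 2)
        (n (insert i I) * m4 + n (insert i I) * (n (insert i I) - 1) * s\<^sup>2)"
      by (rule has_bochner_integral_eqI[OF add[OF add[OF x(4)
              scale[where c = 2, OF x2A]] IH(6)]])
        (simp_all add: A' n' expand)
    show "has_bochner_integral M (\<lambda>\<omega>. A (insert i I) \<omega> * S (insert i I) \<omega> ^ 2)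
        (n (insert i I) * m4 + n (insert i I) * (n (insert i I) - 1) * s\<^sup>2)"
      by (rule has_bochner_integral_eqI[OF add[OF add[OF add[OF add[OF add[OF x(4)
              scale[where c = 2, OF x3S]] x2S2] x2A] scale[where c = 2, OF xAS]] IH(7)]])
        (simp_all add: S' A' n' expand)
    show "has_bochner_integral M (\<lambda>\<omega>. S (insert i I) \<omega> ^ 4)
        (n (insert i I) * m4 + 3 * n (insert i I) * (n (insert i I) - 1) * s\<^sup>2)"
      by (rule has_bochner_integral_eqI[OF add[OF add[OF add[OF add[OF x(4)
              scale[where c = 4, OF x3S]] scale[where c = 6, OF x2S2]]
              scale[where c = 4, OF xS3]] IH(8)]])
        (simp_all add: S' n' expand)
  qed
qed

text \<open>
  With \<open>A\<close> the sum of squares and \<open>S\<close> the sum of the observations, the sample variance is a multiple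
  of \<open>A - S\<^sup>2 / K\<close>. Squaring it produces the monomials \<open>A\<^sup>2\<close>, \<open>A S\<^sup>2\<close> and \<open>S\<^sup>4\<close>.
\<close>

lemma sample_variance_moments:
  fixes Y :: "nat \<Rightarrow> 'a \<Rightarrow> real" and s m3 m4 :: real
  assumes "K \<ge> 2" "indep_vars (\<lambda>_. borel) Y {1..K}"
    and "\<And>j. j \<in> {1..K} \<Longrightarrow> has_bochner_integral M (Y j) 0"
    and "\<And>j. j \<in> {1..K} \<Longrightarrow> has_bochner_integral M (\<lambda>\<omega>. Y j \<omega> ^ 2) s"
    and "\<And>j. j \<in> {1..K} \<Longrightarrow> has_bochner_integral M (\<lambda>\<omega>. Y j \<omega> ^ 3) m3"
    and "\<And>j. j \<in> {1..K} \<Longrightarrow> has_bochner_integral M (\<lambda>\<omega>. Y j \<omega> ^ 4) m4"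
  defines "V \<equiv> \<lambda>\<omega>. sample_variance K (\<lambda>j. Y j \<omega>)"
  shows "integrable M (\<lambda>\<omega>. (V \<omega>)\<^sup>2)"
    and "expectation V = s"
    and "variance V = m4 / real K - s\<^sup>2 * (real K - 3) / (real K * (real K - 1))"
proof -
  define S where "S = (\<lambda>\<omega>. \<Sum>j=1..K. Y j \<omega>)"
  define A where "A = (\<lambda>\<omega>. \<Sum>j=1..K. (Y j \<omega>)\<^sup>2)"
  define k where "k = real K"
  have k: "k \<ge> 2" using assms(1) by (simp add: k_def)
  have V: "V \<omega> = (A \<omega> - S \<omega> ^ 2 / k) / (k - 1)" for \<omega>
    using assms(1) by (simp add: V_def A_def S_def k_def sample_variance_power_sums)
  have mom: "has_bochner_integral M A (k * s)"
    "has_bochner_integral M (\<lambda>\<omega>. S \<omega> ^ 2) (k * s)"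
    "has_bochner_integral M (\<lambda>\<omega>. A \<omega> ^ 2) (k * m4 + k * (k - 1) * s\<^sup>2)"
    "has_bochner_integral M (\<lambda>\<omega>. A \<omega> * S \<omega> ^ 2) (k * m4 + k * (k - 1) * s\<^sup>2)"
    "has_bochner_integral M (\<lambda>\<omega>. S \<omega> ^ 4) (k * m4 + 3 * k * (k - 1) * s\<^sup>2)"
    using power_sum_moments[OF _ assms(2-6)] by (simp_all add: A_def S_def k_def)
  note add = has_bochner_integral_add
  note scale = has_bochner_integral_scale
  \<comment> \<open>With \<open>d = k - 1\<close> the denominators become monomials in \<open>d\<close> and \<open>d + 1\<close> and can be cleared.\<close>
  obtain d where d: "k = d + 1" "d \<noteq> 0" "d + 1 \<noteq> 0"
    using k by (intro that[of "k - 1"]) auto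
  have first: "has_bochner_integral M V s"
  proof (rule has_bochner_integral_eqI[OF add[OF scale[where c = "1 / (k - 1)", OF mom(1)]
          scale[where c = "- 1 / (k * (k - 1))", OF mom(2)]]])
    show "1 / (k - 1) * A \<omega> + - 1 / (k * (k - 1)) * S \<omega> ^ 2 = V \<omega>" for \<omega>
      by (simp add: V diff_divide_distrib)
    show "1 / (k - 1) * (k * s) + - 1 / (k * (k - 1)) * (k * s) = s"
      unfolding d(1) using d(2,3) by (simp add: divide_simps) (simp add: algebra_simps)
  qed
  let ?c = "1 / (k - 1)\<^sup>2"
  have second: "has_bochner_integral M (\<lambda>\<omega>. (V \<omega>)\<^sup>2)
      (?c * (k * m4 + k * (k - 1) * s\<^sup>2) - 2 / k * ?c * (k * m4 + k * (k - 1) * s\<^sup>2)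
        + 1 / k\<^sup>2 * ?c * (k * m4 + 3 * k * (k - 1) * s\<^sup>2))"
  proof (rule has_bochner_integral_eqI[OF add[OF add[OF scale[where c = ?c, OF mom(3)]
            scale[where c = "- (2 / k * ?c)", OF mom(4)]]
            scale[where c = "1 / k\<^sup>2 * ?c", OF mom(5)]]])
    fix \<omega>
    have "(V \<omega>)\<^sup>2 = (A \<omega> - S \<omega> ^ 2 / k)\<^sup>2 * ?c"
      by (simp add: V power_divide)
    also have "(A \<omega> - S \<omega> ^ 2 / k)\<^sup>2 = A \<omega> ^ 2 - 2 / k * (A \<omega> * S \<omega> ^ 2) + 1 / k\<^sup>2 * S \<omega> ^ 4"
      by (simp add: power2_diff power_divide flip: power_mult)
    finally show "?c * A \<omega> ^ 2 + - (2 / k * ?c) * (A \<omega> * S \<omega> ^ 2) + 1 / k\<^sup>2 * ?c * S \<omega> ^ 4 = (V \<omega>)\<^sup>2"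
      by (simp add: algebra_simps)
  qed auto
  show int2: "integrable M (\<lambda>\<omega>. (V \<omega>)\<^sup>2)" and mean: "expectation V = s"
    using first second by (auto simp: has_bochner_integral_iff)
  have "variance V = expectation (\<lambda>\<omega>. (V \<omega>)\<^sup>2) - (expectation V)\<^sup>2"
    using first int2 by (intro variance_eq) (auto simp: has_bochner_integral_iff)
  also have "\<dots> = ?c * (k * m4 + k * (k - 1) * s\<^sup>2) - 2 / k * ?c * (k * m4 + k * (k - 1) * s\<^sup>2)
        + 1 / k\<^sup>2 * ?c * (k * m4 + 3 * k * (k - 1) * s\<^sup>2) - s\<^sup>2"
    using second mean by (simp add: has_bochner_integral_iff)
  also have "\<dots> = m4 / k - s\<^sup>2 * (k - 3) / (k * (k - 1))"
    unfolding d(1) using d(2,3)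
    by (simp add: divide_simps power2_eq_square) (simp add: algebra_simps)
  finally show "variance V = m4 / real K - s\<^sup>2 * (real K - 3) / (real K * (real K - 1))"
    by (simp add: k_def)
qed

lemma gaussian_moments:
  assumes [measurable]: "random_variable borel Y"
    and Y: "distr M borel Y = gaussian 0 s" and "s > 0"
  shows "has_bochner_integral M Y 0"
    and "has_bochner_integral M (\<lambda>\<omega>. Y \<omega> ^ 2) s"
    and "has_bochner_integral M (\<lambda>\<omega>. Y \<omega> ^ 3) 0"
    and "has_bochner_integral M (\<lambda>\<omega>. Y \<omega> ^ 4) (3 * s\<^sup>2)"
proof -
  have transfer: "has_bochner_integral M (\<lambda>\<omega>. Y \<omega> ^ k) m"
    if "has_bochner_integral lborel (\<lambda>x. normal_density 0 (sqrt s) x * x ^ k) m" for k m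
  proof -
    have "has_bochner_integral (distr M borel Y) (\<lambda>x. x ^ k) m"
      unfolding Y gaussian_def using that \<open>s > 0\<close>
      by (auto intro!: has_bochner_integral_density)
    then show ?thesis
      by (simp add: has_bochner_integral_iff integrable_distr_eq integral_distr)
  qed
  have \<sigma>: "sqrt s > 0" using \<open>s > 0\<close> by simp
  show "has_bochner_integral M Y 0"
    using transfer[of 1 0] normal_moment_odd[OF \<sigma>, of 0 0] by simp
  show "has_bochner_integral M (\<lambda>\<omega>. Y \<omega> ^ 2) s"
    using transfer[of 2 s] normal_moment_even[OF \<sigma>, of 0 1] \<open>s > 0\<close>
    by (simp add: fact_numeral)
  show "has_bochner_integral M (\<lambda>\<omega>. Y \<omega> ^ 3) 0"
    using transfer[of 3 0] normal_moment_odd[OF \<sigma>, of 0 1] by simp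
  show "has_bochner_integral M (\<lambda>\<omega>. Y \<omega> ^ 4) (3 * s\<^sup>2)"
    using transfer[of 4 "3 * s\<^sup>2"] normal_moment_even[OF \<sigma>, of 0 2] \<open>s > 0\<close>
    by (simp add: fact_numeral power_divide)
qed

lemma gaussian_sample_variance:
  fixes Y :: "nat \<Rightarrow> 'a \<Rightarrow> real"
  assumes "K \<ge> 2" "indep_vars (\<lambda>_. borel) Y {1..K}" "s > 0"
    and "\<And>j. j \<in> {1..K} \<Longrightarrow> distr M borel (Y j) = gaussian 0 s"
  defines "V \<equiv> \<lambda>\<omega>. sample_variance K (\<lambda>j. Y j \<omega>)"
  shows "integrable M (\<lambda>\<omega>. (V \<omega>)\<^sup>2)"
    and "expectation V = s"
    and "variance V = 2 * s\<^sup>2 / (real K - 1)"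
proof -
  have rv: "random_variable borel (Y j)" if "j \<in> {1..K}" for j
    using assms(2) that by (auto simp: indep_vars_def)
  note moments = gaussian_moments[OF rv assms(4) \<open>s > 0\<close>]
  note V = sample_variance_moments[OF assms(1,2) moments]
  show "integrable M (\<lambda>\<omega>. (V \<omega>)\<^sup>2)" "expectation V = s"
    unfolding V_def using V(1,2) by auto
  have "variance V = 3 * s\<^sup>2 / real K - s\<^sup>2 * (real K - 3) / (real K * (real K - 1))"
    unfolding V_def using V(3) by auto
  also have "\<dots> = 2 * s\<^sup>2 / (real K - 1)"
    using assms(1) by (simp add: field_simps)
  finally show "variance V = 2 * s\<^sup>2 / (real K - 1)" .
qed

section \<open>Simultaneous deviation bounds\<close>

text \<open>
  A union bound would give the sum of the Chebyshev bounds. Independence allows the sharper product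
  form: all deviations are small with probability equal to a product, each factor of which is at
  least its Chebyshev bound and, being a probability, nonnegative. The truncation at 0 is essential
  for multiplying these lower bounds.
\<close>

lemma indep_vars_Chebyshev_simultaneous:
  fixes Z :: "'i \<Rightarrow> 'a \<Rightarrow> real"
  assumes "finite I" "I \<noteq> {}" and indep: "indep_vars (\<lambda>_. borel) Z I"
    and sq: "\<And>i. i \<in> I \<Longrightarrow> integrable M (\<lambda>\<omega>. (Z i \<omega>)\<^sup>2)"
    and "\<eta> > 0"
  shows "prob {\<omega> \<in> space M. \<exists>i\<in>I. \<eta> \<le> \<bar>Z i \<omega> - expectation (Z i)\<bar>}
    \<le> 1 - (\<Prod>i\<in>I. max (1 - variance (Z i) / \<eta>\<^sup>2) 0)"
proof -
  have rv [measurable]: "random_variable borel (Z i)" if "i \<in> I" for i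
    using indep that by (auto simp: indep_vars_def)
  let ?B = "\<lambda>i. {z. \<bar>z - expectation (Z i)\<bar> < \<eta>}"
  let ?G = "\<lambda>i. Z i -` ?B i \<inter> space M"
  have B: "?B i \<in> sets borel" for i
    by measurable
  have G: "?G i \<in> events" if "i \<in> I" for i
    using rv[OF that] B by (rule measurable_sets)
  have single: "max (1 - variance (Z i) / \<eta>\<^sup>2) 0 \<le> prob (?G i)" if "i \<in> I" for i
  proof -
    have "?G i = space M - {\<omega> \<in> space M. \<eta> \<le> \<bar>Z i \<omega> - expectation (Z i)\<bar>}"
      by auto
    moreover have "{\<omega> \<in> space M. \<eta> \<le> \<bar>Z i \<omega> - expectation (Z i)\<bar>} \<in> events"
      using that by measurable
    ultimately have "prob (?G i) = 1 - prob {\<omega> \<in> space M. \<eta> \<le> \<bar>Z i \<omega> - expectation (Z i)\<bar>}"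
      by (simp add: prob_compl)
    then show ?thesis
      using Chebyshev_inequality[OF rv[OF that] sq[OF that] \<open>\<eta> > 0\<close>] by simp
  qed
  have "(\<Prod>i\<in>I. max (1 - variance (Z i) / \<eta>\<^sup>2) 0) \<le> (\<Prod>i\<in>I. prob (?G i))"
    using single by (intro prod_mono) auto
  also have "\<dots> = prob (\<Inter>i\<in>I. ?G i)"
    using indep_varsD[OF indep assms(2,1), of ?B] B by simp
  finally have "(\<Prod>i\<in>I. max (1 - variance (Z i) / \<eta>\<^sup>2) 0) \<le> prob (\<Inter>i\<in>I. ?G i)" .
  moreover have "{\<omega> \<in> space M. \<exists>i\<in>I. \<eta> \<le> \<bar>Z i \<omega> - expectation (Z i)\<bar>} = space M - (\<Inter>i\<in>I. ?G i)"
    using \<open>I \<noteq> {}\<close> by (auto simp: not_less) (metis leD)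
  moreover have "(\<Inter>i\<in>I. ?G i) \<in> events"
    using G assms(1,2) by (intro sets.finite_INT) auto
  ultimately show ?thesis
    by (simp add: prob_compl)
qed

text \<open>
  The sample variances of different rows of a doubly indexed independent family are functions of
  disjoint blocks of it, hence independent.
\<close>

lemma gaussian_sample_variances_deviation:
  fixes \<xi> :: "nat \<Rightarrow> nat \<Rightarrow> 'a \<Rightarrow> real" and s :: "nat \<Rightarrow> real"
  assumes "N \<ge> 1" "K \<ge> 2"
    and indep: "indep_vars (\<lambda>_. borel) (\<lambda>(i, j). \<xi> i j) ({1..N} \<times> {1..K})"
    and law: "\<And>i j. i \<in> {1..N} \<Longrightarrow> j \<in> {1..K} \<Longrightarrow> distr M borel (\<xi> i j) = gaussian 0 (s i)"
    and s: "\<And>i. i \<in> {1..N} \<Longrightarrow> s i > 0" and "\<eta> > 0"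
  defines "V \<equiv> \<lambda>i \<omega>. sample_variance K (\<lambda>j. \<xi> i j \<omega>)"
  shows "{\<omega> \<in> space M. \<exists>i\<in>{1..N}. \<eta> \<le> \<bar>V i \<omega> - s i\<bar>} \<in> events" (is ?meas)
    and "prob {\<omega> \<in> space M. \<exists>i\<in>{1..N}. \<eta> \<le> \<bar>V i \<omega> - s i\<bar>}
      \<le> 1 - (\<Prod>i=1..N. max (1 - 2 * (s i)\<^sup>2 / (\<eta>\<^sup>2 * (real K - 1))) 0)" (is ?bound)
proof -
  have "indep_vars (\<lambda>i. PiM ({i} \<times> {1..K}) (\<lambda>_. borel))
      (\<lambda>i \<omega>. restrict (\<lambda>p. (\<lambda>(i, j). \<xi> i j) p \<omega>) ({i} \<times> {1..K})) {1..N}"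
    by (rule indep_vars_restrict[OF indep]) (auto simp: disjoint_family_on_def)
  \<comment> \<open>The sample variance reads only the indices in \<open>{1..K}\<close>. The default 0 elsewhere makes each
    coordinate map measurable on the product over the block.\<close>
  then have "indep_vars (\<lambda>_. borel)
      (\<lambda>i \<omega>. sample_variance K (\<lambda>j. if j \<in> {1..K} then
        restrict (\<lambda>p. (\<lambda>(i, j). \<xi> i j) p \<omega>) ({i} \<times> {1..K}) (i, j) else 0)) {1..N}"
    by (rule indep_vars_compose2[where Y =
          "\<lambda>i y. sample_variance K (\<lambda>j. if j \<in> {1..K} then y (i, j) else 0)"])
      (auto simp: sample_variance_def sample_mean_def intro!: borel_measurable_sum
          borel_measurable_divide borel_measurable_power borel_measurable_diff)
  moreover have "sample_variance K (\<lambda>j. if j \<in> {1..K} then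
      restrict (\<lambda>p. (\<lambda>(i, j). \<xi> i j) p \<omega>) ({i} \<times> {1..K}) (i, j) else 0) = V i \<omega>" for i \<omega>
    unfolding V_def by (rule sample_variance_cong) auto
  ultimately have indep_V: "indep_vars (\<lambda>_. borel) V {1..N}"
    by simp
  have row: "indep_vars (\<lambda>_. borel) (\<xi> i) {1..K}" if i: "i \<in> {1..N}" for i
  proof -
    have "indep_vars (\<lambda>j. PiM {(i, j)} (\<lambda>_. borel))
        (\<lambda>j \<omega>. restrict (\<lambda>p. (\<lambda>(i, j). \<xi> i j) p \<omega>) {(i, j)}) {1..K}"
      using i by (intro indep_vars_restrict[OF indep]) (auto simp: disjoint_family_on_def)
    then have "indep_vars (\<lambda>_. borel)
        (\<lambda>j \<omega>. restrict (\<lambda>p. (\<lambda>(i, j). \<xi> i j) p \<omega>) {(i, j)} (i, j)) {1..K}"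
      by (rule indep_vars_compose2[where Y = "\<lambda>j y. y (i, j)"]) auto
    then show ?thesis by simp
  qed
  have V: "integrable M (\<lambda>\<omega>. (V i \<omega>)\<^sup>2)" "expectation (V i) = s i"
    "variance (V i) = 2 * (s i)\<^sup>2 / (real K - 1)" if "i \<in> {1..N}" for i
    unfolding V_def using gaussian_sample_variance[OF \<open>K \<ge> 2\<close> row s law] that by blast+
  have [measurable]: "random_variable borel (V i)" if "i \<in> {1..N}" for i
    using indep_V that by (auto simp: indep_vars_def)
  show ?meas by measurable
  have "prob {\<omega> \<in> space M. \<exists>i\<in>{1..N}. \<eta> \<le> \<bar>V i \<omega> - expectation (V i)\<bar>}
      \<le> 1 - (\<Prod>i=1..N. max (1 - variance (V i) / \<eta>\<^sup>2) 0)"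
    using \<open>N \<ge> 1\<close> V(1) \<open>\<eta> > 0\<close>
    by (intro indep_vars_Chebyshev_simultaneous[OF _ _ indep_V]) auto
  also have "{\<omega> \<in> space M. \<exists>i\<in>{1..N}. \<eta> \<le> \<bar>V i \<omega> - expectation (V i)\<bar>} =
      {\<omega> \<in> space M. \<exists>i\<in>{1..N}. \<eta> \<le> \<bar>V i \<omega> - s i\<bar>}"
    using V(2) by auto
  also have "(\<Prod>i=1..N. max (1 - variance (V i) / \<eta>\<^sup>2) 0) =
      (\<Prod>i=1..N. max (1 - 2 * (s i)\<^sup>2 / (\<eta>\<^sup>2 * (real K - 1))) 0)"
    using V(3) by (intro prod.cong) (simp_all add: mult.commute)
  finally show ?bound .
qed

end

section \<open>The smallest sample variance\<close>

theorem theorem2: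
  fixes T L :: real
    and a :: "real \<Rightarrow> real ^ 'd \<Rightarrow> real ^ 'm ^ 'd"
    and b :: "real \<Rightarrow> real ^ 'd \<Rightarrow> real ^ 'd"
    and c h :: "real \<Rightarrow> real ^ 'd \<Rightarrow> real"
    and g :: "real ^ 'd \<Rightarrow> real"
    and v :: "real \<Rightarrow> real ^ 'd \<Rightarrow> real"
    and \<X> :: "(real ^ 'd) set"
    and \<nu> :: "(real ^ 'd) measure"
    and r :: "real ^ 'd \<Rightarrow> real"
    and r_min :: real
    and N M :: nat
    and \<Omega> :: "'w measure"
    and X :: "nat \<Rightarrow> 'w \<Rightarrow> real ^ 'd"
    and P :: "(nat \<Rightarrow> real ^ 'd) \<Rightarrow> 'w measure"
    and \<xi> u :: "nat \<Rightarrow> nat \<Rightarrow> 'w \<Rightarrow> real"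
    and u_bar r_bar :: "nat \<Rightarrow> 'w \<Rightarrow> real"
    and i_star :: "'w \<Rightarrow> nat"
    and r_bar_min :: "'w \<Rightarrow> real"
  assumes "T > 0" and "L > 0"
    and "kolmogorov_coefficients T L a b c h"
    and "viscosity_solution T a b c h g v"
    and "prob_space \<nu>" and "sets \<nu> = sets borel" and "\<X> = measure_support \<nu>"
    and "\<And>x. x \<in> \<X> \<Longrightarrow> r x \<ge> 0"
    and "N \<ge> 1" and "M \<ge> 2"
    and "prob_space \<Omega>"
    and "prob_space.indep_vars \<Omega> (\<lambda>_. borel) X {1..N}"
    and "\<And>i. i \<in> {1..N} \<Longrightarrow> distr \<Omega> borel (X i) = \<nu>"
    and "\<And>i j. i \<in> {1..N} \<Longrightarrow> j \<in> {1..M} \<Longrightarrow> \<xi> i j \<in> borel_measurable \<Omega>"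
    and "regular_conditional_probability \<Omega> (PiM {1..N} (\<lambda>_. borel)) (\<lambda>\<omega>. \<lambda>i\<in>{1..N}. X i \<omega>) P"
    and "AE x in PiM {1..N} (\<lambda>_. \<nu>).
           prob_space.indep_vars (P x) (\<lambda>_. borel) (\<lambda>(i, j). \<xi> i j) ({1..N} \<times> {1..M}) \<and>
           (\<forall>i\<in>{1..N}. \<forall>j\<in>{1..M}. distr (P x) borel (\<xi> i j) = gaussian 0 (r (x i)))"
    and "\<And>i j \<omega>. i \<in> {1..N} \<Longrightarrow> j \<in> {1..M} \<Longrightarrow> \<omega> \<in> space \<Omega> \<Longrightarrow>
           u i j \<omega> = v 0 (X i \<omega>) + \<xi> i j \<omega>"
    and "\<And>i \<omega>. i \<in> {1..N} \<Longrightarrow> \<omega> \<in> space \<Omega> \<Longrightarrow> u_bar i \<omega> = sample_mean M (\<lambda>j. u i j \<omega>)"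
    and "AE x in PiM {1..N} (\<lambda>_. \<nu>).
           multivariate_gaussian (P x) {1..N} u_bar (\<lambda>i. v 0 (x i))
             (\<lambda>i j. 1 / real M * noise_matrix r x i j)"
    and "r_min \<in> r ` \<X>" and "\<And>x. x \<in> \<X> \<Longrightarrow> r_min \<le> r x" and "r_min > 0"
    and "\<And>i \<omega>. i \<in> {1..N} \<Longrightarrow> \<omega> \<in> space \<Omega> \<Longrightarrow> r_bar i \<omega> = sample_variance M (\<lambda>j. u i j \<omega>)"
    and "i_star \<in> measurable \<Omega> (count_space UNIV)"
    and "\<And>\<omega>. \<omega> \<in> space \<Omega> \<Longrightarrow> is_arg_min (\<lambda>i. r_bar i \<omega>) (\<lambda>i. i \<in> {1..N}) (i_star \<omega>)"
    and "\<And>\<omega>. \<omega> \<in> space \<Omega> \<Longrightarrow> r_bar_min \<omega> = r_bar (i_star \<omega>) \<omega>"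
  shows "AE x in PiM {1..N} (\<lambda>_. \<nu>). \<forall>\<delta> \<epsilon>. 0 < \<delta> \<longrightarrow> \<delta> < \<epsilon> \<longrightarrow>
           measure (P x) {\<omega> \<in> space (P x).
               \<bar>r_bar_min \<omega> - r_min\<bar> \<ge> \<epsilon> \<and> \<delta> > \<bar>r (x (i_star \<omega>)) - r_min\<bar>}
           \<le> 1 - (\<Prod>i=1..N. max (1 - 2 * (r (x i))\<^sup>2 / ((\<epsilon> - \<delta>)\<^sup>2 * (real M - 1))) 0)"
proof -
  have support: "AE x in PiM {1..N} (\<lambda>_. \<nu>). \<forall>i\<in>{1..N}. x i \<in> \<X>"
    unfolding \<open>\<X> = measure_support \<nu>\<close>
    using \<open>prob_space \<nu>\<close> AE_in_measure_support[OF \<open>sets \<nu> = sets borel\<close>]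
    by (intro AE_finite_allI AE_PiM_component) auto
  have design: "AE x in PiM {1..N} (\<lambda>_. \<nu>). x \<in> space (PiM {1..N} (\<lambda>_. \<nu>))"
    by (rule AE_space)
  show ?thesis
    using support design assms(16)
  proof eventually_elim
    case (elim x)
    have "space \<nu> = UNIV"
      using sets_eq_imp_space_eq[OF \<open>sets \<nu> = sets borel\<close>] by simp
    then have "x \<in> space (PiM {1..N} (\<lambda>_. borel))"
      using elim(2) by (simp add: space_PiM)
    moreover have "P \<in> measurable (PiM {1..N} (\<lambda>_. borel)) (prob_algebra \<Omega>)"
      using assms(15) by (simp add: regular_conditional_probability_def)
    ultimately have "P x \<in> space (prob_algebra \<Omega>)"
      by (rule measurable_space[rotated])
    then have P: "prob_space (P x)" "sets (P x) = sets \<Omega>"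
      by (auto simp: space_prob_algebra)
    then have space_P: "space (P x) = space \<Omega>"
      by (intro sets_eq_imp_space_eq)
    interpret Q: prob_space "P x" by (rule P)
    have r_pos: "r (x i) > 0" if "i \<in> {1..N}" for i
      using elim(1) that assms(21)[of "x i"] \<open>r_min > 0\<close> by force
    show ?case
    proof (intro allI impI)
      fix \<delta> \<epsilon> :: real
      assume "0 < \<delta>" "\<delta> < \<epsilon>"
      let ?V = "\<lambda>i \<omega>. sample_variance M (\<lambda>j. \<xi> i j \<omega>)"
      let ?D = "{\<omega> \<in> space (P x). \<exists>i\<in>{1..N}. \<epsilon> - \<delta> \<le> \<bar>?V i \<omega> - r (x i)\<bar>}"
      have indep: "Q.indep_vars (\<lambda>_. borel) (\<lambda>(i, j). \<xi> i j) ({1..N} \<times> {1..M})"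
        and law: "\<And>i j. i \<in> {1..N} \<Longrightarrow> j \<in> {1..M} \<Longrightarrow> distr (P x) borel (\<xi> i j) = gaussian 0 (r (x i))"
        using elim(3) by blast+
      have "\<epsilon> - \<delta> > 0"
        using \<open>\<delta> < \<epsilon>\<close> by simp
      note dev = Q.gaussian_sample_variances_deviation
        [OF \<open>N \<ge> 1\<close> \<open>M \<ge> 2\<close> indep law r_pos \<open>\<epsilon> - \<delta> > 0\<close>]
      have "{\<omega> \<in> space (P x). \<bar>r_bar_min \<omega> - r_min\<bar> \<ge> \<epsilon> \<and> \<delta> > \<bar>r (x (i_star \<omega>)) - r_min\<bar>} \<subseteq> ?D"
      proof clarify
        fix \<omega>
        assume \<omega>: "\<omega> \<in> space (P x)" and far: "\<epsilon> \<le> \<bar>r_bar_min \<omega> - r_min\<bar>"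
          and near: "\<bar>r (x (i_star \<omega>)) - r_min\<bar> < \<delta>"
        then have \<omega>': "\<omega> \<in> space \<Omega>" by (simp add: space_P)
        have i: "i_star \<omega> \<in> {1..N}"
          using assms(25)[OF \<omega>'] by (auto simp: is_arg_min_def)
        have "r_bar_min \<omega> = sample_variance M (\<lambda>j. u (i_star \<omega>) j \<omega>)"
          using assms(23,26) \<omega>' i by simp
        also have "\<dots> = sample_variance M (\<lambda>j. v 0 (X (i_star \<omega>) \<omega>) + \<xi> (i_star \<omega>) j \<omega>)"
          using assms(17) \<omega>' i by (intro sample_variance_cong) auto
        also have "\<dots> = ?V (i_star \<omega>) \<omega>"
          using \<open>M \<ge> 2\<close> by (intro sample_variance_shift) auto
        finally have "\<epsilon> - \<delta> \<le> \<bar>?V (i_star \<omega>) \<omega> - r (x (i_star \<omega>))\<bar>"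
          using far near by linarith
        with i show "\<exists>i\<in>{1..N}. \<epsilon> - \<delta> \<le> \<bar>?V i \<omega> - r (x i)\<bar>" by blast
      qed
      then have "Q.prob {\<omega> \<in> space (P x).
            \<bar>r_bar_min \<omega> - r_min\<bar> \<ge> \<epsilon> \<and> \<delta> > \<bar>r (x (i_star \<omega>)) - r_min\<bar>} \<le> Q.prob ?D"
        using dev(1) by (rule Q.finite_measure_mono)
      also note dev(2)
      finally show "Q.prob {\<omega> \<in> space (P x).
            \<bar>r_bar_min \<omega> - r_min\<bar> \<ge> \<epsilon> \<and> \<delta> > \<bar>r (x (i_star \<omega>)) - r_min\<bar>}
          \<le> 1 - (\<Prod>i=1..N. max (1 - 2 * (r (x i))\<^sup>2 / ((\<epsilon> - \<delta>)\<^sup>2 * (real M - 1))) 0)" .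
    qed
  qed
qed

end
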